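(* For all $x\in[0,1]$ and all integers $k\geq 3$ we have $f_k(x)\geq f_{k-1}(x)$.
   Context: A $k$-graph is a (finite, simple) hypergraph in which every edge consists of exactly $k$ vertices. For a $k$-graph $\mathcal{H}$, the codegree of a $(k-1)$-set $A$ of vertices is the number of vertices $v\notin A$ such that $A\cup\{v\}$ is an edge; the minimum codegree $\delta_{k-1}(\mathcal{H})$ is the minimum of this over all $(k-1)$-sets of vertices of $\mathcal{H}$. A tight walk in a $k$-graph is a finite sequence of edges in which consecutive edges share $k-1$ vertices. The tight components of $\mathcal{H}$ are the equivalence classes of edges under the relation that two edges are related if there is a tight walk in $\mathcal{H}$ from one to the other. A tight component meets (or covers) a vertex if some edge in the component contains that vertex. For each integer $k\geq 2$, the function $f_k:[0,1]\to[0,1]$ is defined by letting $f_k(x)$ be the largest real number such that every $n$-vertex $k$-graph with minimum codegree at least $xn-O(1)$ has a tight component meeting at least $f_k(x)n$ of its vertices. This is understood asymptotically as $n\to\infty$: $f_k(x)$ is the supremum of all $c\in[0,1]$ such that for every constant $C\geq 0$ there is $n_0$ such that in every $k$-graph on $n\geq n_0$ vertices with minimum codegree at least $xn-C$, the maximum number of vertices met by a tight component (taken to be $0$ if there are no edges) is at least $cn$. *)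

theory Defs
  imports Complex_Main
begin

definition kgraph :: "nat \<Rightarrow> 'a set \<Rightarrow> 'a set set \<Rightarrow> bool" where
  "kgraph k V E \<longleftrightarrow> finite V \<and> (\<forall>e\<in>E. e \<subseteq> V \<and> card e = k)"

definition codegree :: "'a set \<Rightarrow> 'a set set \<Rightarrow> 'a set \<Rightarrow> nat" where
  "codegree V E A = card {v \<in> V - A. A \<union> {v} \<in> E}"

(* If V has fewer than k - 1 vertices this is Min {}, an unspecified value; such V are
   irrelevant for fk below, where only sufficiently large vertex sets matter. *)
definition min_codegree :: "nat \<Rightarrow> 'a set \<Rightarrow> 'a set set \<Rightarrow> nat" where
  "min_codegree k V E = Min (codegree V E ` {A. A \<subseteq> V \<and> card A = k - 1})"

definition tight_walk :: "nat \<Rightarrow> 'a set set \<Rightarrow> 'a set list \<Rightarrow> bool" where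
  "tight_walk k E es \<longleftrightarrow> es \<noteq> [] \<and> set es \<subseteq> E \<and>
     (\<forall>i. Suc i < length es \<longrightarrow> card (es ! i \<inter> es ! Suc i) = k - 1)"

definition tight_rel :: "nat \<Rightarrow> 'a set set \<Rightarrow> ('a set \<times> 'a set) set" where
  "tight_rel k E = {(e, e'). \<exists>es. tight_walk k E es \<and> hd es = e \<and> last es = e'}"

definition tight_components :: "nat \<Rightarrow> 'a set set \<Rightarrow> 'a set set set" where
  "tight_components k E = E // tight_rel k E"

definition covered :: "'a set set \<Rightarrow> 'a set" where
  "covered T = {v. \<exists>e\<in>T. v \<in> e}"

definition max_cover :: "nat \<Rightarrow> 'a set set \<Rightarrow> nat" where
  "max_cover k E =
     (if E = {} then 0 else Max ((\<lambda>T. card (covered T)) ` tight_components k E))"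

(* Vertices are taken to be natural numbers; up to isomorphism this loses no finite k-graph. *)
definition fk :: "nat \<Rightarrow> real \<Rightarrow> real" where
  "fk k x = Sup {c. 0 \<le> c \<and> c \<le> 1 \<and>
     (\<forall>C\<ge>0. \<exists>n0::nat. \<forall>n\<ge>n0. \<forall>(V::nat set) E.
        kgraph k V E \<and> card V = n \<and> real (min_codegree k V E) \<ge> x * real n - C \<longrightarrow>
        real (max_cover k E) \<ge> c * real n)}"

lemma equiv_tight_rel: "equiv E (tight_rel k E)"
proof (rule equivI)
  show "tight_rel k E \<subseteq> E \<times> E"
    by (auto simp: tight_rel_def tight_walk_def)
  show "refl_on E (tight_rel k E)"
  proof (rule refl_onI)
    fix e assume "e \<in> E"
    then have "tight_walk k E [e]" by (simp add: tight_walk_def)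
    then show "(e, e) \<in> tight_rel k E" unfolding tight_rel_def by fastforce
  qed
  show "sym (tight_rel k E)"
  proof (rule symI)
    fix a b assume "(a, b) \<in> tight_rel k E"
    then obtain es where es: "tight_walk k E es" "hd es = a" "last es = b"
      by (auto simp: tight_rel_def)
    have "card (rev es ! i \<inter> rev es ! Suc i) = k - 1" if i: "Suc i < length es" for i
    proof -
      define j where "j = length es - Suc (Suc i)"
      have j: "Suc j < length es" "rev es ! i = es ! Suc j" "rev es ! Suc i = es ! j"
        using i by (auto simp: j_def rev_nth Suc_diff_Suc)
      then show ?thesis using es(1) by (simp add: tight_walk_def Int_commute)
    qed
    with es have "tight_walk k E (rev es) \<and> hd (rev es) = b \<and> last (rev es) = a"
      by (simp add: tight_walk_def hd_rev last_rev)
    then show "(b, a) \<in> tight_rel k E" unfolding tight_rel_def by blast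
  qed
  show "trans (tight_rel k E)"
  proof (rule transI)
    fix a b c assume "(a, b) \<in> tight_rel k E" "(b, c) \<in> tight_rel k E"
    then obtain es fs where es: "tight_walk k E es" "hd es = a" "last es = b"
      and fs: "tight_walk k E fs" "hd fs = b" "last fs = c"
      by (auto simp: tight_rel_def)
    from fs obtain gs where gs: "fs = b # gs" by (cases fs) (auto simp: tight_walk_def)
    let ?l = "length es"
    have ne: "es \<noteq> []" using es(1) by (simp add: tight_walk_def)
    have "card ((es @ gs) ! i \<inter> (es @ gs) ! Suc i) = k - 1"
      if i: "Suc i < length (es @ gs)" for i
    proof (cases "Suc i < ?l")
      case True
      then show ?thesis using es(1) by (simp add: tight_walk_def nth_append)
    next
      case False
      define j where "j = Suc i - ?l"
      have "(es @ gs) ! i = fs ! j"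
      proof (cases "Suc i = ?l")
        case True
        then have "i = ?l - 1" by simp
        then show ?thesis using True ne es(3) gs
          by (simp add: j_def nth_append last_conv_nth)
      next
        case F: False
        then have "?l \<le> i" "j = Suc (i - ?l)" using False by (auto simp: j_def)
        then show ?thesis using gs by (simp add: nth_append)
      qed
      moreover have "(es @ gs) ! Suc i = fs ! Suc j"
        using False gs by (simp add: j_def nth_append)
      moreover have "Suc j < length fs" using i False gs by (auto simp: j_def)
      ultimately show ?thesis using fs(1) by (simp add: tight_walk_def)
    qed
    then have "tight_walk k E (es @ gs)"
      using es(1) fs(1) gs by (auto simp: tight_walk_def)
    moreover have "hd (es @ gs) = a" "last (es @ gs) = c"
      using es fs gs ne by (auto simp: last_append)
    ultimately show "(a, c) \<in> tight_rel k E" unfolding tight_rel_def by blast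
  qed
qed

end

theory Submission
  imports Defs
begin

text \<open>
  The idea is to pass to the link of a vertex. Fix a vertex \<open>v\<close> of a \<open>k\<close>-graph on \<open>n\<close> vertices
  with minimum codegree at least \<open>x n - C\<close>. The link of \<open>v\<close> is a \<open>(k - 1)\<close>-graph on the
  remaining \<open>n - 1\<close> vertices, and its minimum codegree is no smaller, since the codegree of \<open>A\<close>
  in the link is the codegree of \<open>A \<union> {v}\<close> in the original hypergraph
  (\<open>codegree_link\<close>, \<open>min_codegree_link\<close>). Hence, for every constant \<open>c\<close> admissible in the
  definition of \<open>f\<^bsub>k-1\<^esub>(x)\<close> and all large \<open>n\<close>, some tight component of the link meets at least
  \<open>c (n - 1)\<close> vertices.

  Adding \<open>v\<close> to every edge turns a tight walk of the link into a tight walk of the hypergraph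
  (\<open>tight_rel_insert\<close>), so this component lies, after adding \<open>v\<close>, inside a single tight
  component, which meets in addition the vertex \<open>v\<close> itself (\<open>max_cover_link\<close>). It therefore
  meets at least \<open>c (n - 1) + 1 \<ge> c n\<close> vertices, because \<open>c \<le> 1\<close>. So \<open>c\<close> is also admissible in
  the definition of \<open>f\<^bsub>k\<^esub>(x)\<close>; the vertex gained in \<open>v\<close> pays for the one lost in passing
  to the link.
\<close>

definition link :: "'a \<Rightarrow> 'a set set \<Rightarrow> 'a set set" where
  "link v E = {e. v \<notin> e \<and> insert v e \<in> E}"

lemma kgraph_finite_edges:
  assumes "kgraph k V E"
  shows "finite E"
proof (rule finite_subset)
  show "E \<subseteq> Pow V" using assms by (auto simp: kgraph_def)
  show "finite (Pow V)" using assms by (simp add: kgraph_def)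
qed

lemma kgraph_link:
  assumes "kgraph k V E"
  shows "kgraph (k - 1) (V - {v}) (link v E)"
  unfolding kgraph_def
proof (intro conjI ballI)
  show "finite (V - {v})" using assms by (simp add: kgraph_def)
  fix e assume "e \<in> link v E"
  then have e: "v \<notin> e" "insert v e \<in> E" by (auto simp: link_def)
  then have sub: "insert v e \<subseteq> V" and crd: "card (insert v e) = k" and "finite V"
    using assms by (auto simp: kgraph_def)
  then have "finite e" by (meson finite_insert finite_subset)
  show "e \<subseteq> V - {v}" using sub e(1) by blast
  show "card e = k - 1" using crd e(1) \<open>finite e\<close> by simp
qed

lemma codegree_link:
  assumes "v \<notin> A"
  shows "codegree (V - {v}) (link v E) A = codegree V E (insert v A)"
proof -
  have "{w \<in> V - {v} - A. A \<union> {w} \<in> link v E} = {w \<in> V - insert v A. insert v A \<union> {w} \<in> E}"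
    using assms by (auto simp: link_def insert_commute)
  then show ?thesis by (simp add: codegree_def)
qed

text \<open>
  Every \<open>(k - 2)\<close>-set of the link becomes a \<open>(k - 1)\<close>-set by adding \<open>v\<close>, so the minimum for the
  link is over a subfamily of the codegrees of \<open>E\<close>. The lower bound on the number of vertices
  makes this subfamily nonempty.
\<close>

lemma min_codegree_link:
  assumes "finite V" "v \<in> V" "k \<ge> 2" "card V \<ge> k"
  shows "min_codegree k V E \<le> min_codegree (k - 1) (V - {v}) (link v E)"
proof -
  let ?S = "{A. A \<subseteq> V - {v} \<and> card A = k - 1 - 1}"
  let ?S' = "{A. A \<subseteq> V \<and> card A = k - 1}"
  have fin: "finite ?S" "finite ?S'" using assms(1) by auto
  have "k - 1 - 1 \<le> card (V - {v})" using assms by simp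
  then obtain B where "B \<subseteq> V - {v}" "card B = k - 1 - 1"
    by (rule obtain_subset_with_card_n)
  then have ne: "?S \<noteq> {}" by blast
  have "codegree (V - {v}) (link v E) ` ?S \<subseteq> codegree V E ` ?S'"
  proof (rule image_subsetI)
    fix A assume A: "A \<in> ?S"
    then have "finite A" "v \<notin> A" using assms(1) by (auto intro: finite_subset)
    then have "insert v A \<in> ?S'" using A assms by auto
    then show "codegree (V - {v}) (link v E) A \<in> codegree V E ` ?S'"
      using codegree_link[OF \<open>v \<notin> A\<close>, of V E] by auto
  qed
  then show ?thesis unfolding min_codegree_def
    using fin ne by (intro Min_antimono) auto
qed

text \<open>
  Adding \<open>v\<close> to two edges of the link enlarges their intersection by exactly one vertex, so it
  maps tight walks to tight walks of the next uniformity.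
\<close>

lemma tight_rel_insert:
  assumes "kgraph k V E" "k \<ge> 2" "(e, e') \<in> tight_rel (k - 1) (link v E)"
  shows "(insert v e, insert v e') \<in> tight_rel k E"
proof -
  obtain es where es: "tight_walk (k - 1) (link v E) es" "hd es = e" "last es = e'"
    using assms(3) by (auto simp: tight_rel_def)
  let ?fs = "map (insert v) es"
  have ne: "es \<noteq> []" and sub: "set es \<subseteq> link v E" using es(1) by (auto simp: tight_walk_def)
  have "card (?fs ! i \<inter> ?fs ! Suc i) = k - 1" if i: "Suc i < length ?fs" for i
  proof -
    let ?I = "es ! i \<inter> es ! Suc i"
    have mem: "es ! i \<in> link v E" using i sub by (auto simp: subset_iff)
    then have "es ! i \<subseteq> V - {v}" "finite (V - {v})"
      using kgraph_link[OF assms(1), of v] by (auto simp: kgraph_def)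
    then have "finite ?I" "v \<notin> ?I" by (auto intro: finite_subset)
    moreover have "card ?I = k - 1 - 1" using es(1) i by (simp add: tight_walk_def)
    moreover have "?fs ! i \<inter> ?fs ! Suc i = insert v ?I" using i by auto
    ultimately show ?thesis using assms(2) by simp
  qed
  moreover have "set ?fs \<subseteq> E" using sub by (auto simp: link_def)
  ultimately have "tight_walk k E ?fs" using ne by (simp add: tight_walk_def)
  moreover have "hd ?fs = insert v e" "last ?fs = insert v e'"
    using ne es by (simp_all add: hd_map last_map)
  ultimately show ?thesis unfolding tight_rel_def by blast
qed

lemma finite_tight_components:
  assumes "finite E"
  shows "finite (tight_components k E)"
  unfolding tight_components_def
  using assms equiv_tight_rel[of E k] by (intro finite_quotient) (auto simp: equiv_def)

lemma card_covered_le_max_cover: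
  assumes "finite E" "T \<in> tight_components k E"
  shows "card (covered T) \<le> max_cover k E"
proof -
  have "E \<noteq> {}" using assms(2) by (auto simp: tight_components_def quotient_def)
  then show ?thesis
    using assms finite_tight_components[OF assms(1)] by (simp add: max_cover_def)
qed

lemma max_cover_attained:
  assumes "finite E" "E \<noteq> {}"
  obtains T where "T \<in> tight_components k E" "max_cover k E = card (covered T)"
proof -
  have "tight_components k E \<noteq> {}" using assms(2) by (simp add: tight_components_def)
  then have "Max ((\<lambda>T. card (covered T)) ` tight_components k E)
      \<in> (\<lambda>T. card (covered T)) ` tight_components k E"
    using finite_tight_components[OF assms(1)] by (intro Max_in) auto
  then show ?thesis using that assms(2) by (auto simp: max_cover_def)
qed

text \<open>
  A tight component of the link, with \<open>v\<close> added to all its edges, lies in a single tight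
  component of the hypergraph; the extra \<open>1\<close> counts \<open>v\<close>, which the link avoids.
\<close>

lemma max_cover_link:
  assumes H: "kgraph k V E" and k: "k \<ge> 2" and ne: "link v E \<noteq> {}"
  shows "max_cover (k - 1) (link v E) + 1 \<le> max_cover k E"
proof -
  let ?L = "link v E"
  have finE: "finite E" and finL: "finite ?L"
    using kgraph_finite_edges[OF H] kgraph_finite_edges[OF kgraph_link[OF H]] by auto
  obtain T where T: "T \<in> tight_components (k - 1) ?L"
    and mT: "max_cover (k - 1) ?L = card (covered T)"
    using max_cover_attained[OF finL ne] by blast
  obtain e where e: "e \<in> ?L" and Te: "T = tight_rel (k - 1) ?L `` {e}"
    using T by (auto simp: tight_components_def quotient_def)
  define T' where "T' = tight_rel k E `` {insert v e}"
  have "insert v e \<in> E" using e by (simp add: link_def)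
  then have T': "T' \<in> tight_components k E"
    by (auto simp: tight_components_def T'_def quotientI)
  have sub': "T' \<subseteq> E"
    using equiv_tight_rel[of E k] by (auto simp: T'_def equiv_def)
  have subT: "T \<subseteq> ?L"
    using equiv_tight_rel[of ?L "k - 1"] by (auto simp: Te equiv_def)
  have lift: "insert v f \<in> T'" if "f \<in> T" for f
    using that tight_rel_insert[OF H k] by (auto simp: Te T'_def)
  have "e \<in> T" using equiv_class_self[OF equiv_tight_rel e] by (simp add: Te)
  with lift have cov: "insert v (covered T) \<subseteq> covered T'"
    unfolding covered_def by blast
  have "covered T' \<subseteq> V" using sub' H by (auto simp: covered_def kgraph_def)
  then have fin': "finite (covered T')" using H by (auto simp: kgraph_def intro: finite_subset)
  have "v \<notin> covered T" using subT by (auto simp: covered_def link_def)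
  moreover have "finite (covered T)" using cov fin' by (auto intro: finite_subset)
  ultimately have "card (covered T) + 1 = card (insert v (covered T))" by simp
  also have "\<dots> \<le> card (covered T')" using fin' cov by (rule card_mono)
  also have "\<dots> \<le> max_cover k E" using finE T' by (rule card_covered_le_max_cover)
  finally show ?thesis unfolding mT .
qed

theorem proposition3:
  fixes x :: real and k :: nat
  assumes "x \<in> {0..1}" and "k \<ge> 3"
  shows "fk k x \<ge> fk (k - 1) x"
proof -
  define forces :: "nat \<Rightarrow> real \<Rightarrow> real \<Rightarrow> nat \<Rightarrow> bool" where
    "forces j c C n \<longleftrightarrow> (\<forall>(V::nat set) E.
        kgraph j V E \<and> card V = n \<and> real (min_codegree j V E) \<ge> x * real n - C \<longrightarrow>
        real (max_cover j E) \<ge> c * real n)" for j c C n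
  define good :: "nat \<Rightarrow> real \<Rightarrow> bool" where
    "good j c \<longleftrightarrow> 0 \<le> c \<and> c \<le> 1 \<and> (\<forall>C\<ge>0. \<exists>n0. \<forall>n\<ge>n0. forces j c C n)" for j c
  have fk_good: "fk j x = Sup {c. good j c}" for j by (simp add: fk_def good_def forces_def)
  have step: "good k c" if c: "good (k - 1) c" for c
    unfolding good_def
  proof (intro conjI allI impI)
    show c01: "0 \<le> c" "c \<le> 1" using c by (auto simp: good_def)
    fix C :: real assume "C \<ge> 0"
    with c obtain n0 where n0: "\<forall>n\<ge>n0. forces (k - 1) c C n"
      by (auto simp: good_def)
    have "real (max_cover k E) \<ge> c * real (card V)"
      if n: "card V \<ge> max (Suc n0) k" and H: "kgraph k V E"
        and deg: "real (min_codegree k V E) \<ge> x * real (card V) - C" for V :: "nat set" and E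
    proof -
      have finV: "finite V" using H by (simp add: kgraph_def)
      have "V \<noteq> {}" using n assms(2) by auto
      then obtain v where v: "v \<in> V" by blast
      let ?W = "V - {v}" and ?L = "link v E"
      have cW: "card ?W = card V - 1" "real (card V) = real (card ?W) + 1"
        using v finV n assms(2) by auto
      have "x * real (card ?W) \<le> x * real (card V)"
        using assms(1) cW(2) by (intro mult_left_mono) auto
      moreover have "min_codegree k V E \<le> min_codegree (k - 1) ?W ?L"
        using finV v assms(2) n by (intro min_codegree_link) auto
      ultimately have "real (min_codegree (k - 1) ?W ?L) \<ge> x * real (card ?W) - C"
        using deg by linarith
      moreover have "n0 \<le> card ?W" using n cW(1) by linarith
      then have "forces (k - 1) c C (card ?W)" using n0 by blast
      ultimately have cover: "real (max_cover (k - 1) ?L) \<ge> c * real (card ?W)"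
        using kgraph_link[OF H, of v] unfolding forces_def by blast
      show ?thesis
      proof (cases "?L = {}")
        case True
        \<comment> \<open>An edgeless link covers nothing, so the lower bound on its cover forces \<open>c = 0\<close>.\<close>
        then have "c * real (card ?W) \<le> 0" using cover by (simp add: max_cover_def)
        moreover have "real (card ?W) > 0" using cW(1) n assms(2) by simp
        ultimately have "c = 0" using c01(1) by (simp add: mult_le_0_iff)
        then show ?thesis by simp
      next
        case False
        then have "max_cover (k - 1) ?L + 1 \<le> max_cover k E"
          using assms(2) by (intro max_cover_link[OF H]) auto
        then have "c * real (card ?W) + 1 \<le> real (max_cover k E)" using cover by linarith
        moreover have "c * real (card V) = c * real (card ?W) + c"
          by (simp add: cW(2) distrib_left)
        ultimately show ?thesis using c01(2) by linarith
      qed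
    qed
    then have "\<forall>n\<ge>max (Suc n0) k. forces k c C n" unfolding forces_def by blast
    then show "\<exists>n0. \<forall>n\<ge>n0. forces k c C n" ..
  qed
  \<comment> \<open>Suprema of real sets compare only if the smaller set is nonempty; \<open>0\<close> is always a member.\<close>
  have "good (k - 1) 0" by (simp add: good_def forces_def)
  moreover have "bdd_above {c. good k c}" by (auto simp: good_def bdd_above_def)
  ultimately show ?thesis unfolding fk_good
    using step by (intro cSup_subset_mono) auto
qed

end
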